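(* Let $X$ be a locally convex real vector space and let $T : X \to X$ be a continuous linear operator that is hypercyclic. If $P$ is a non-zero polynomial with real coefficients, then the operator $P(T) : X \to X$ has dense range.
   Context: Let $X$ be a locally convex vector space and $T : X \to X$ a continuous linear operator. For $x \in X$, the orbit of $x$ under $T$ is $\mathrm{Orb}\{x, T\} = \{x, Tx, T^2x, \dots\}$. The operator $T$ is called hypercyclic if there exists some $x \in X$ whose orbit $\mathrm{Orb}\{x,T\}$ is dense in $X$; such an $x$ is called a hypercyclic vector for $T$. For a polynomial $P(t) = \sum_{k=0}^{d} c_k t^k$, $P(T)$ denotes the operator $\sum_{k=0}^{d} c_k T^k$, with $T^0 = I$ the identity. *)

theory Defs
  imports "HOL-Analysis.Analysis" "HOL-Computational_Algebra.Polynomial"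
begin

(* No separation axiom is part of the definition, so Hausdorff and
   non-Hausdorff spaces are both instances. *)
class real_topological_vector = real_vector + topological_ab_group_add +
  assumes tendsto_scaleR_Pair:
    "LIM p (nhds a \<times>\<^sub>F nhds x). fst p *\<^sub>R snd p :> nhds (a *\<^sub>R x)"

(* The class axiom spells out "convex V" because the constant convex carries
   the sort real_vector and cannot occur in a class specification. *)
class real_locally_convex = real_topological_vector +
  assumes convex_nhds_base_0_raw:
    "open U \<Longrightarrow> 0 \<in> U \<Longrightarrow> \<exists>V. open V \<and>
      (\<forall>x\<in>V. \<forall>y\<in>V. \<forall>u\<ge>0. \<forall>v\<ge>0. u + v = 1 \<longrightarrow> u *\<^sub>R x + v *\<^sub>R y \<in> V) \<and>
      0 \<in> V \<and> V \<subseteq> U"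

lemma convex_nhds_base_0:
  fixes U :: "'a::real_locally_convex set"
  assumes "open U" "0 \<in> U"
  shows "\<exists>V. open V \<and> convex V \<and> 0 \<in> V \<and> V \<subseteq> U"
  using convex_nhds_base_0_raw[OF assms] unfolding convex_def .

definition orbit_of :: "'a \<Rightarrow> ('a \<Rightarrow> 'a) \<Rightarrow> 'a set" where
  "orbit_of x T = range (\<lambda>n::nat. (T ^^ n) x)"

definition hypercyclic_vector :: "('a::topological_space \<Rightarrow> 'a) \<Rightarrow> 'a \<Rightarrow> bool" where
  "hypercyclic_vector T x \<longleftrightarrow> closure (orbit_of x T) = UNIV"

definition hypercyclic :: "('a::topological_space \<Rightarrow> 'a) \<Rightarrow> bool" where
  "hypercyclic T \<longleftrightarrow> (\<exists>x. hypercyclic_vector T x)"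

definition poly_op :: "real poly \<Rightarrow> ('a::real_vector \<Rightarrow> 'a) \<Rightarrow> 'a \<Rightarrow> 'a" where
  "poly_op P T x = (\<Sum>k\<le>degree P. coeff P k *\<^sub>R (T ^^ k) x)"

instance real_normed_vector \<subseteq> real_locally_convex
proof
  fix a :: real and x :: 'a
  show "LIM p (nhds a \<times>\<^sub>F nhds x). fst p *\<^sub>R snd p :> nhds (a *\<^sub>R x)"
    by (intro tendsto_scaleR filterlim_fst filterlim_snd)
next
  fix U :: "'a set"
  assume "open U" "0 \<in> U"
  then obtain e where "e > 0" "ball 0 e \<subseteq> U"
    using open_contains_ball by blast
  then have "open (ball (0::'a) e) \<and> convex (ball (0::'a) e) \<and> (0::'a) \<in> ball 0 e \<and> ball 0 e \<subseteq> U"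
    by auto
  then show "\<exists>V. open V \<and>
      (\<forall>x\<in>V. \<forall>y\<in>V. \<forall>u\<ge>0. \<forall>v\<ge>0. u + v = 1 \<longrightarrow> u *\<^sub>R x + v *\<^sub>R y \<in> V) \<and>
      0 \<in> V \<and> V \<subseteq> U"
    unfolding convex_def by blast
qed

end

theory Submission
  imports Defs "HOL-Computational_Algebra.Fundamental_Theorem_Algebra"
begin

text \<open>
  A composition of continuous maps with dense range has dense range, and \<open>P(T)\<close> is, up to a
  non-zero factor, a composition of operators \<open>m(T)\<close> for the minimal polynomials \<open>m\<close> over the reals of the complex roots
  of \<open>P\<close>. So it suffices to treat \<open>m\<close>, the minimal polynomial of a complex number \<open>\<lambda>\<close>.

  Let \<open>R\<close> be the range of \<open>m(T)\<close>. It is invariant under \<open>T\<close>, and modulo \<open>R\<close> the operator \<open>T\<close>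
  is multiplication by \<open>\<lambda>\<close>, where \<open>K = (T - Re \<lambda>) / Im \<lambda>\<close> plays the imaginary unit
  (and \<open>K = 0\<close> when \<open>\<lambda>\<close> is real). Hence \<open>T\<^sup>n x\<close> is \<open>\<lambda>\<^sup>n x\<close> modulo \<open>R\<close>
  (\<open>funpow_mod_subspace\<close>). If \<open>x\<close> is a hypercyclic vector, these multiples of
  \<open>x\<close> come arbitrarily close to every vector \<open>c x\<close> modulo \<open>R\<close>. But the numbers
  \<open>c - \<lambda>\<^sup>n\<close> are bounded away from 0 for \<open>c = 0\<close> if \<open>|\<lambda>| > 1\<close>, and for \<open>c = 3\<close>
  otherwise. Dividing \<open>(c - \<lambda>\<^sup>n) x\<close>, which is small modulo \<open>R\<close>, by the complex scalar
  \<open>c - \<lambda>\<^sup>n\<close> shows that \<open>x\<close> itself is small modulo \<open>R\<close>, that is, \<open>x\<close> lies in the closure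
  of \<open>R\<close> (\<open>mem_closure_if_small_combinations\<close>). This closure is \<open>T\<close>-invariant, so it
  contains the dense orbit of \<open>x\<close> (\<open>hypercyclic_invariant_subspace_dense\<close>).
\<close>

section \<open>Topological vector spaces\<close>

lemma continuous_on_scaleR_const:
  fixes f :: "'b::topological_space \<Rightarrow> 'a::real_topological_vector"
  assumes "continuous_on S f"
  shows "continuous_on S (\<lambda>x. c *\<^sub>R f x)"
  unfolding continuous_on_def
proof
  fix x assume "x \<in> S"
  then have f: "(f \<longlongrightarrow> f x) (at x within S)"
    using assms by (auto simp: continuous_on_def)
  have "LIM y (at x within S). (c, f y) :> nhds c \<times>\<^sub>F nhds (f x)"
    by (rule filterlim_Pair[OF tendsto_const f])
  from filterlim_compose[OF tendsto_scaleR_Pair this]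
  show "((\<lambda>y. c *\<^sub>R f y) \<longlongrightarrow> c *\<^sub>R f x) (at x within S)" by simp
qed

lemma symmetric_convex_nhds_base_0:
  fixes U :: "'a::real_locally_convex set"
  assumes "open U" "0 \<in> U"
  obtains V where "open V" "convex V" "0 \<in> V" "V \<subseteq> U" "\<And>v. v \<in> V \<Longrightarrow> - v \<in> V"
proof -
  obtain W where W: "open W" "convex W" "0 \<in> W" "W \<subseteq> U"
    using convex_nhds_base_0[OF assms] by blast
  have uminus: "uminus -` W = uminus ` W"
  proof
    show "uminus -` W \<subseteq> uminus ` W"
      by (metis imageI minus_minus subsetI vimageE)
  qed auto
  have "open (uminus -` W)"
    by (rule open_vimage[OF W(1)]) (intro continuous_intros)
  moreover have "convex (uminus -` W)"
    unfolding uminus by (rule convex_negations[OF W(2)])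
  ultimately show ?thesis
    using W by (intro that[of "W \<inter> uminus -` W"]) (auto intro: convex_Int)
qed

lemma symmetric_convex_scaleR_mem:
  fixes V :: "'a::real_vector set"
  assumes "convex V" "\<And>v. v \<in> V \<Longrightarrow> - v \<in> V" "v \<in> V" "\<bar>t\<bar> \<le> 1"
  shows "t *\<^sub>R v \<in> V"
proof -
  have "((1 + t) / 2) *\<^sub>R v + ((1 - t) / 2) *\<^sub>R (- v) \<in> V"
    using assms by (intro convexD) (auto simp: field_simps)
  moreover have "((1 + t) / 2) *\<^sub>R v + ((1 - t) / 2) *\<^sub>R (- v) = t *\<^sub>R v"
    unfolding scaleR_minus_right add_uminus_conv_diff scaleR_diff_left[symmetric]
    by (simp add: field_simps)
  ultimately show ?thesis by simp
qed

text \<open>Neighbourhoods that absorb the combinations \<open>s u + t K u\<close> uniformly in bounded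
  \<open>s\<close>, \<open>t\<close> play the role of a bound on the operator norm of the inverse of a complex scalar:
  dividing a small vector by a complex number that is not small must give a small vector.\<close>

lemma nhd_0_uniform_combination:
  fixes W :: "'a::real_locally_convex set"
  assumes "open W" "0 \<in> W" "linear K" "continuous_on UNIV K"
  obtains U where "open U" "0 \<in> U"
    "\<And>u s t. u \<in> U \<Longrightarrow> \<bar>s\<bar> \<le> 1 \<Longrightarrow> \<bar>t\<bar> \<le> 1 \<Longrightarrow> s *\<^sub>R u + t *\<^sub>R K u \<in> W"
proof -
  obtain V where V: "open V" "convex V" "0 \<in> V" "V \<subseteq> W" "\<And>v. v \<in> V \<Longrightarrow> - v \<in> V"
    using symmetric_convex_nhds_base_0[OF assms(1,2)] by blast
  define U where "U = (\<lambda>u. 2 *\<^sub>R u) -` V \<inter> (\<lambda>u. 2 *\<^sub>R K u) -` V"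
  have "open U"
    unfolding U_def
    by (intro open_Int open_vimage[OF V(1)] continuous_on_scaleR_const continuous_on_id assms(4))
  moreover have "0 \<in> U"
    using V(3) linear_0[OF assms(3)] by (simp add: U_def)
  moreover have "s *\<^sub>R u + t *\<^sub>R K u \<in> W" if "u \<in> U" "\<bar>s\<bar> \<le> 1" "\<bar>t\<bar> \<le> 1" for u s t
  proof -
    have "s *\<^sub>R (2 *\<^sub>R u) \<in> V" "t *\<^sub>R (2 *\<^sub>R K u) \<in> V"
      using that by (auto simp: U_def intro!: symmetric_convex_scaleR_mem[OF V(2,5)]
        simp del: scaleR_scaleR)
    then have "(1/2) *\<^sub>R (s *\<^sub>R (2 *\<^sub>R u)) + (1/2) *\<^sub>R (t *\<^sub>R (2 *\<^sub>R K u)) \<in> V"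
      by (intro convexD[OF V(2)]) auto
    then show ?thesis using V(4) by auto
  qed
  ultimately show ?thesis using that by blast
qed

lemma closure_translate_nhd_0:
  fixes y :: "'a::topological_ab_group_add"
  assumes "y \<in> closure S" "open U" "0 \<in> U"
  obtains z where "z \<in> S" "y - z \<in> U"
proof -
  have "open ((\<lambda>z. y - z) -` U)"
    by (rule open_vimage[OF assms(2)]) (intro continuous_intros)
  moreover have "y \<in> (\<lambda>z. y - z) -` U" using assms(3) by simp
  ultimately obtain z where "z \<in> S" "z \<in> (\<lambda>z. y - z) -` U"
    using assms(1) closure_iff_nhds_not_empty[of y S] by blast
  then show ?thesis using that by auto
qed

lemma mem_closure_translate:
  fixes y :: "'a::topological_ab_group_add"
  assumes "\<And>W. open W \<Longrightarrow> 0 \<in> W \<Longrightarrow> \<exists>w\<in>W. y - w \<in> S"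
  shows "y \<in> closure S"
  unfolding closure_iff_nhds_not_empty
proof (intro allI impI)
  fix A V assume *: "V \<subseteq> A" "open V" "y \<in> V"
  have "open ((\<lambda>w. y - w) -` V)"
    by (rule open_vimage[OF *(2)]) (intro continuous_intros)
  from assms[OF this] *(1,3) show "S \<inter> A \<noteq> {}" by auto
qed

section \<open>Operators that act as a complex scalar modulo a subspace\<close>

text \<open>Modulo \<open>R\<close>, \<open>a + b K\<close> has the conjugate \<open>a - b K\<close>, and their product is the real
  number \<open>D = a\<^sup>2 + e b\<^sup>2\<close>. So if \<open>(a + b K) x\<close> is \<open>u\<close> modulo \<open>R\<close>, then \<open>x\<close>
  is \<open>(a u - b K u) / D\<close>, which is small with \<open>u\<close> as the coefficients \<open>a / D\<close> and
  \<open>b / D\<close> are bounded. The parameter \<open>e\<close> is 1 when \<open>K\<close> is an imaginary unit and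
  0 when \<open>K = 0\<close>, which treats non-real and real scalars at once.\<close>

lemma mem_closure_if_small_combinations:
  fixes R :: "'a::real_locally_convex set"
  assumes R: "subspace R" and KR: "\<And>y. y \<in> R \<Longrightarrow> K y \<in> R"
    and K: "linear K" "continuous_on UNIV K"
    and K2: "\<And>y. K (K y) + e *\<^sub>R y \<in> R"
    and small: "\<And>U. open U \<Longrightarrow> 0 \<in> U \<Longrightarrow> \<exists>a b. a *\<^sub>R x + b *\<^sub>R K x \<in> (\<Union>u\<in>U. (\<lambda>r. u + r) ` R) \<and>
      a\<^sup>2 + e * b\<^sup>2 > 0 \<and> \<bar>a\<bar> \<le> a\<^sup>2 + e * b\<^sup>2 \<and> \<bar>b\<bar> \<le> a\<^sup>2 + e * b\<^sup>2"
  shows "x \<in> closure R"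
proof (rule mem_closure_translate)
  fix W :: "'a set" assume "open W" "0 \<in> W"
  then obtain U where U: "open U" "0 \<in> U"
    "\<And>u s t. u \<in> U \<Longrightarrow> \<bar>s\<bar> \<le> 1 \<Longrightarrow> \<bar>t\<bar> \<le> 1 \<Longrightarrow> s *\<^sub>R u + t *\<^sub>R K u \<in> W"
    using nhd_0_uniform_combination[OF _ _ K] by blast
  obtain a b u r where *: "a *\<^sub>R x + b *\<^sub>R K x = u + r" "u \<in> U" "r \<in> R"
    and D: "a\<^sup>2 + e * b\<^sup>2 > 0" "\<bar>a\<bar> \<le> a\<^sup>2 + e * b\<^sup>2" "\<bar>b\<bar> \<le> a\<^sup>2 + e * b\<^sup>2"
    using small[OF U(1,2)] by blast
  define D where "D = a\<^sup>2 + e * b\<^sup>2"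
  define w where "w = (a / D) *\<^sub>R u + (- b / D) *\<^sub>R K u"
  have Dpos: "D > 0" using D by (simp add: D_def)
  have "K (a *\<^sub>R x + b *\<^sub>R K x) = K (u + r)"
    using *(1) by simp
  then have Kxx: "a *\<^sub>R K x + b *\<^sub>R K (K x) = K u + K r"
    by (simp add: linear_add[OF K(1)] linear_scale[OF K(1)])
  have "D *\<^sub>R x = a *\<^sub>R (a *\<^sub>R x + b *\<^sub>R K x) - b *\<^sub>R (a *\<^sub>R K x + b *\<^sub>R K (K x))
      + b\<^sup>2 *\<^sub>R (K (K x) + e *\<^sub>R x)"
    by (simp add: D_def algebra_simps power2_eq_square)
  also have "\<dots> = D *\<^sub>R w + (a *\<^sub>R r - b *\<^sub>R K r + b\<^sup>2 *\<^sub>R (K (K x) + e *\<^sub>R x))"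
    unfolding *(1) Kxx using Dpos by (simp add: w_def algebra_simps)
  finally have "D *\<^sub>R (x - w) = a *\<^sub>R r - b *\<^sub>R K r + b\<^sup>2 *\<^sub>R (K (K x) + e *\<^sub>R x)"
    by (simp add: algebra_simps)
  moreover have "\<dots> \<in> R"
    by (intro subspace_add subspace_diff subspace_scale R KR K2 *(3))
  ultimately have "(1 / D) *\<^sub>R (D *\<^sub>R (x - w)) \<in> R"
    by (metis subspace_scale[OF R])
  then have "x - w \<in> R" using Dpos by simp
  moreover have "w \<in> W"
    unfolding w_def using D Dpos by (intro U(3) *(2)) (auto simp: D_def)
  ultimately show "\<exists>w\<in>W. x - w \<in> R" by blast
qed

lemma funpow_mod_subspace:
  fixes R :: "'a::real_vector set"
  assumes R: "subspace R" and TR: "\<And>y. y \<in> R \<Longrightarrow> T y \<in> R" and T: "linear T" and K: "linear K"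
    and K2: "\<And>y. K (K y) + e *\<^sub>R y \<in> R"
    and TK: "\<And>y. T y - (Re l *\<^sub>R y + Im l *\<^sub>R K y) \<in> R"
    and e: "e = 1 \<or> Im l = 0"
  shows "(T ^^ n) x - (Re (l ^ n) *\<^sub>R x + Im (l ^ n) *\<^sub>R K x) \<in> R"
proof (induction n)
  case 0
  then show ?case using subspace_0[OF R] by simp
next
  case (Suc n)
  define s t where "s = Re (l ^ n)" and "t = Im (l ^ n)"
  define y where "y = s *\<^sub>R x + t *\<^sub>R K x"
  have e': "Im l * e = Im l" using e by auto
  have "T ((T ^^ n) x - y) + (T y - (Re l *\<^sub>R y + Im l *\<^sub>R K y))
      + (Im l * t) *\<^sub>R (K (K x) + e *\<^sub>R x) \<in> R"
    using Suc by (intro subspace_add subspace_scale R TR K2 TK) (simp add: s_def t_def y_def)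
  also have "T ((T ^^ n) x - y) + (T y - (Re l *\<^sub>R y + Im l *\<^sub>R K y))
      + (Im l * t) *\<^sub>R (K (K x) + e *\<^sub>R x)
    = T ((T ^^ n) x) - ((Re l * s - (Im l * e) * t) *\<^sub>R x + (Re l * t + Im l * s) *\<^sub>R K x)"
    by (simp add: y_def linear_add[OF K] linear_scale[OF K] linear_diff[OF T] algebra_simps)
  finally show ?case
    unfolding e' by (simp add: s_def t_def)
qed

text \<open>A subspace modulo which a hypercyclic operator is a complex scalar \<open>l\<close> must be dense, because
  the powers of a complex number stay away from 0 or from 3, whereas the orbit of a
  hypercyclic vector \<open>x\<close> approaches both \<open>0\<close> and \<open>3 x\<close>.\<close>

lemma hypercyclic_invariant_subspace_dense:
  fixes T :: "'a::real_locally_convex \<Rightarrow> 'a"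
  assumes T: "linear T" "continuous_on UNIV T" "hypercyclic T"
    and R: "subspace R" and TR: "\<And>y. y \<in> R \<Longrightarrow> T y \<in> R"
    and K: "linear K" "continuous_on UNIV K" and KR: "\<And>y. y \<in> R \<Longrightarrow> K y \<in> R"
    and K2: "\<And>y. K (K y) + e *\<^sub>R y \<in> R"
    and TK: "\<And>y. T y - (Re l *\<^sub>R y + Im l *\<^sub>R K y) \<in> R"
    and e: "e = 1 \<or> e = 0 \<and> Im l = 0"
  shows "closure R = UNIV"
proof -
  obtain x where x: "closure (orbit_of x T) = UNIV"
    using T(3) by (auto simp: hypercyclic_def hypercyclic_vector_def)
  define c :: real where "c = (if norm l > 1 then 0 else 3)"
  have "x \<in> closure R"
  proof (rule mem_closure_if_small_combinations[OF R KR K K2])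
    fix U :: "'a set" assume U: "open U" "0 \<in> U"
    have "c *\<^sub>R x \<in> closure (orbit_of x T)" using x by simp
    then obtain n where n: "c *\<^sub>R x - (T ^^ n) x \<in> U"
      using closure_translate_nhd_0[OF _ U] unfolding orbit_of_def by blast
    define a b where "a = c - Re (l ^ n)" and "b = - Im (l ^ n)"
    have r: "(T ^^ n) x - (Re (l ^ n) *\<^sub>R x + Im (l ^ n) *\<^sub>R K x) \<in> R"
      using e by (intro funpow_mod_subspace[OF R TR T(1) K(1) K2 TK]) auto
    have "a *\<^sub>R x + b *\<^sub>R K x = (c *\<^sub>R x - (T ^^ n) x)
        + ((T ^^ n) x - (Re (l ^ n) *\<^sub>R x + Im (l ^ n) *\<^sub>R K x))"
      by (simp add: a_def b_def algebra_simps)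
    then have mem: "a *\<^sub>R x + b *\<^sub>R K x \<in> (\<Union>u\<in>U. (\<lambda>r. u + r) ` R)"
      using n r by blast
    have Im0: "Im (l ^ n) = 0" if "Im l = 0"
      using that by (metis complex_is_Real_iff Reals_power)
    have D: "a\<^sup>2 + e * b\<^sup>2 = a\<^sup>2 + b\<^sup>2"
      using e Im0 by (auto simp: b_def)
    have bounds: "a\<^sup>2 + b\<^sup>2 > 0 \<and> \<bar>a\<bar> \<le> a\<^sup>2 + b\<^sup>2 \<and> \<bar>b\<bar> \<le> a\<^sup>2 + b\<^sup>2"
    proof (cases "norm l > 1")
      case True
      have ab: "\<bar>a\<bar> \<le> norm (l ^ n)" "\<bar>b\<bar> \<le> norm (l ^ n)" "a\<^sup>2 + b\<^sup>2 = (norm (l ^ n))\<^sup>2"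
        using True abs_Re_le_cmod[of "l ^ n"] abs_Im_le_cmod[of "l ^ n"]
        by (simp_all add: a_def b_def c_def cmod_power2)
      have "norm (l ^ n) \<ge> 1" using True by (simp add: norm_power)
      then have "norm (l ^ n) \<le> (norm (l ^ n))\<^sup>2" "(norm (l ^ n))\<^sup>2 > 0"
        by (intro self_le_power zero_less_power; linarith)+
      then show ?thesis using ab by linarith
    next
      case False
      have "norm (l ^ n) \<le> 1" using False by (simp add: norm_power power_le_one)
      then have "a \<ge> 2" "\<bar>b\<bar> \<le> 1"
        using False abs_Re_le_cmod[of "l ^ n"] abs_Im_le_cmod[of "l ^ n"]
        by (auto simp: a_def b_def c_def)
      moreover from this have "a * 2 \<le> a\<^sup>2" by (simp add: power2_eq_square)
      moreover have "b\<^sup>2 \<ge> 0" by simp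
      ultimately show ?thesis by linarith
    qed
    show "\<exists>a b. a *\<^sub>R x + b *\<^sub>R K x \<in> (\<Union>u\<in>U. (\<lambda>r. u + r) ` R) \<and>
      a\<^sup>2 + e * b\<^sup>2 > 0 \<and> \<bar>a\<bar> \<le> a\<^sup>2 + e * b\<^sup>2 \<and> \<bar>b\<bar> \<le> a\<^sup>2 + e * b\<^sup>2"
      using mem bounds D by metis
  qed
  moreover have "T ` closure R \<subseteq> closure R"
  proof -
    have "T ` closure R \<subseteq> closure (T ` R)"
      by (rule continuous_image_closure_subset[OF T(2)]) simp
    also have "\<dots> \<subseteq> closure R" using TR by (intro closure_mono) auto
    finally show ?thesis .
  qed
  ultimately have "(T ^^ n) x \<in> closure R" for n
    by (induction n) auto
  then have "closure (orbit_of x T) \<subseteq> closure R"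
    by (intro closure_minimal) (auto simp: orbit_of_def)
  then show ?thesis using x by auto
qed

section \<open>Polynomials in an operator\<close>

lemma poly_op_extend:
  assumes "degree P \<le> n"
  shows "poly_op P T x = (\<Sum>k\<le>n. coeff P k *\<^sub>R (T ^^ k) x)"
  unfolding poly_op_def using assms
  by (intro sum.mono_neutral_left) (auto simp: coeff_eq_0)

lemma poly_op_0 [simp]: "poly_op 0 T x = 0"
  by (simp add: poly_op_def)

lemma poly_op_pCons [simp]: "poly_op (pCons a P) T x = a *\<^sub>R x + poly_op P T (T x)"
proof -
  have "poly_op (pCons a P) T x = (\<Sum>k\<le>Suc (degree P). coeff (pCons a P) k *\<^sub>R (T ^^ k) x)"
    by (rule poly_op_extend[OF degree_pCons_le])
  also have "\<dots> = a *\<^sub>R x + (\<Sum>k\<le>degree P. coeff P k *\<^sub>R (T ^^ k) (T x))"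
    by (simp add: sum.atMost_Suc_shift funpow_swap1 del: sum.atMost_Suc)
  finally show ?thesis by (simp add: poly_op_def)
qed

lemma poly_op_add: "poly_op (P + Q) T x = poly_op P T x + poly_op Q T x"
proof -
  let ?n = "max (degree P) (degree Q)"
  show ?thesis
    unfolding poly_op_extend[OF degree_add_le_max] poly_op_extend[of P ?n, OF max.cobounded1]
      poly_op_extend[of Q ?n, OF max.cobounded2]
    by (simp add: algebra_simps sum.distrib)
qed

lemma poly_op_smult: "poly_op (smult c P) T x = c *\<^sub>R poly_op P T x"
  by (simp add: poly_op_extend[OF degree_smult_le] poly_op_def scaleR_sum_right)

lemma linear_poly_op:
  assumes "linear T"
  shows "linear (poly_op P T)"
proof (induction P)
  case 0
  show ?case by (rule linearI) simp_all
next
  case (pCons a P)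
  show ?case
    by (rule linearI) (simp_all add: linear_add[OF assms] linear_scale[OF assms]
      linear_add[OF pCons.IH] linear_scale[OF pCons.IH] algebra_simps)
qed

lemma continuous_on_poly_op:
  fixes T :: "'a::real_topological_vector \<Rightarrow> 'a"
  assumes "continuous_on UNIV T"
  shows "continuous_on UNIV (poly_op P T)"
proof (induction P)
  case 0
  show ?case by simp
next
  case (pCons a P)
  have "continuous_on UNIV (\<lambda>x. poly_op P T (T x))"
    by (rule continuous_on_compose2[OF pCons.IH assms]) simp
  then show ?case
    by (simp add: continuous_on_add continuous_on_scaleR_const)
qed

lemma poly_op_commute:
  assumes "linear T"
  shows "poly_op P T (T x) = T (poly_op P T x)"
  by (induction P arbitrary: x)
     (simp_all add: linear_0[OF assms] linear_add[OF assms] linear_scale[OF assms])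

lemma poly_op_mult:
  assumes "linear T"
  shows "poly_op (P * Q) T x = poly_op P T (poly_op Q T x)"
proof (induction P arbitrary: x)
  case (pCons a P)
  then show ?case
    by (simp add: poly_op_add poly_op_smult poly_op_commute[OF assms])
qed simp

section \<open>Real minimal polynomial of a complex root\<close>

definition real_min_poly :: "complex \<Rightarrow> real poly" where
  "real_min_poly l =
    (if Im l = 0 then [:- Re l, 1:] else [:(Re l)\<^sup>2 + (Im l)\<^sup>2, - 2 * Re l, 1:])"

text \<open>Multiplication by \<open>l\<close> on the complex plane is a real-linear operator, so the rules for
  polynomials in an operator also give the evaluation of real polynomials at \<open>l\<close>.\<close>

lemma poly_op_mult_complex:
  "poly_op P ((*) l) z = poly (map_poly of_real P) l * (z::complex)"
  by (induction P arbitrary: z) (simp_all add: map_poly_pCons scaleR_conv_of_real algebra_simps)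

lemma degree_real_min_poly: "degree (real_min_poly l) > 0"
  by (simp add: real_min_poly_def)

text \<open>The remainder of \<open>P\<close> modulo the minimal polynomial also vanishes at \<open>l\<close>, and it is
  a real constant if \<open>l\<close> is real and of the form \<open>a + b t\<close> otherwise. For real \<open>a\<close>, \<open>b\<close> and
  non-real \<open>l\<close>, the equation \<open>a + b l = 0\<close> forces \<open>a = b = 0\<close>.\<close>

lemma real_min_poly_dvd:
  assumes "poly (map_poly of_real P) l = (0::complex)"
  shows "real_min_poly l dvd P"
proof -
  let ?m = "real_min_poly l" and ?L = "(*) l"
  have lin: "linear ?L" by (rule linear_times)
  have m: "poly_op ?m ?L 1 = 0"
    by (auto simp: real_min_poly_def complex_eq_iff power2_eq_square algebra_simps)
  define r where "r = P mod ?m"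
  have "P = (P div ?m) * ?m + r" by (simp add: r_def)
  then have "poly_op P ?L 1 = poly_op ((P div ?m) * ?m + r) ?L 1" by (rule arg_cong)
  then have "poly_op P ?L 1 = poly_op (P div ?m) ?L (poly_op ?m ?L 1) + poly_op r ?L 1"
    by (simp only: poly_op_add poly_op_mult[OF lin])
  then have r0: "poly_op r ?L 1 = 0"
    using assms m linear_0[OF linear_poly_op[OF lin]] by (simp add: poly_op_mult_complex)
  have "?m \<noteq> 0" using degree_real_min_poly[of l] by auto
  then have deg: "r = 0 \<or> degree r < degree ?m"
    unfolding r_def by (rule degree_mod_less)
  have "degree r \<le> 1"
    using deg by (auto simp: real_min_poly_def split: if_splits)
  then have ab: "r = [:coeff r 0, coeff r 1:]"
    by (intro poly_eqI) (auto simp: coeff_pCons coeff_eq_0 split: nat.splits)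
  have eq: "coeff r 0 + coeff r 1 * Re l = 0" "coeff r 1 * Im l = 0"
    using r0[unfolded arg_cong[OF ab, of "\<lambda>p. poly_op p ?L 1"]] by (simp_all add: complex_eq_iff)
  have "coeff r 1 = 0"
    using eq(2) deg by (cases "Im l = 0") (auto simp: real_min_poly_def coeff_eq_0)
  then have "r = [:0, 0:]" using eq(1) ab by (metis add_0_right mult_zero_left)
  then have "r = 0" by simp
  then show ?thesis by (simp add: r_def dvd_eq_mod_eq_0)
qed

lemma dense_range_real_min_poly:
  fixes T :: "'a::real_locally_convex \<Rightarrow> 'a"
  assumes T: "linear T" "continuous_on UNIV T" "hypercyclic T"
  shows "closure (range (poly_op (real_min_poly l) T)) = UNIV"
proof -
  let ?q = "real_min_poly l"
  define R where "R = range (poly_op ?q T)"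
  \<comment> \<open>For real \<open>l\<close>, division by zero makes \<open>K = 0\<close>, as wanted.\<close>
  define K where "K y = (1 / Im l) *\<^sub>R (T y - Re l *\<^sub>R y)" for y
  define e :: real where "e = (if Im l = 0 then 0 else 1)"
  have q_mem: "poly_op ?q T y \<in> R" for y by (simp add: R_def)
  have R: "subspace R"
    unfolding R_def by (rule linear_subspace_image[OF linear_poly_op[OF T(1)] subspace_UNIV])
  have TR: "T y \<in> R" if "y \<in> R" for y
    using that poly_op_commute[OF T(1), of ?q] by (metis R_def image_iff rangeI)
  have KR: "K y \<in> R" if "y \<in> R" for y
    unfolding K_def using that by (intro subspace_scale subspace_diff R TR)
  have linK: "linear K"
    by (rule linearI) (simp_all add: K_def linear_add[OF T(1)] linear_scale[OF T(1)] algebra_simps)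
  have contK: "continuous_on UNIV K"
    unfolding K_def
    by (intro continuous_on_scaleR_const continuous_on_diff T(2) continuous_on_id)
  have TK: "T y - (Re l *\<^sub>R y + Im l *\<^sub>R K y) \<in> R" for y
    using q_mem[of y] subspace_0[OF R]
    by (cases "Im l = 0") (auto simp: K_def real_min_poly_def)
  have K2: "K (K y) + e *\<^sub>R y \<in> R" for y
  proof (cases "Im l = 0")
    case True
    then show ?thesis using subspace_0[OF R] by (simp add: K_def e_def)
  next
    case False
    have "(1 / (Im l)\<^sup>2) *\<^sub>R poly_op ?q T y \<in> R"
      by (intro subspace_scale R q_mem)
    also have "(1 / (Im l)\<^sup>2) *\<^sub>R poly_op ?q T y = K (K y) + e *\<^sub>R y"
    proof -
      have "K (K y) + e *\<^sub>R y = (1 / (Im l)\<^sup>2) *\<^sub>R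
        (T (T y) - (Re l *\<^sub>R T y + Re l *\<^sub>R T y) + (Re l)\<^sup>2 *\<^sub>R y + (Im l)\<^sup>2 *\<^sub>R y)"
        using False by (simp add: K_def e_def linear_diff[OF T(1)] linear_scale[OF T(1)]
          algebra_simps power2_eq_square)
      moreover have "Re l *\<^sub>R T y + Re l *\<^sub>R T y = (2 * Re l) *\<^sub>R T y"
        by (simp only: mult_2 scaleR_add_left)
      ultimately show ?thesis using False by (simp add: real_min_poly_def algebra_simps)
    qed
    finally show ?thesis .
  qed
  have "e = 1 \<or> e = 0 \<and> Im l = 0" by (simp add: e_def)
  from hypercyclic_invariant_subspace_dense[OF T R TR linK contK KR K2 TK this]
  show ?thesis by (simp add: R_def)
qed

theorem mainTheorem1:
  fixes T :: "'a::real_locally_convex \<Rightarrow> 'a"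
    and P :: "real poly"
  assumes "linear T"
    and "continuous_on UNIV T"
    and "hypercyclic T"
    and "P \<noteq> 0"
  shows "closure (range (poly_op P T)) = UNIV"
  using assms(4)
proof (induction "degree P" arbitrary: P rule: less_induct)
  case less
  show ?case
  proof (cases "degree P = 0")
    case True
    then obtain c where c: "P = [:c:]" "c \<noteq> 0"
      using less.prems by (metis degree_eq_zeroE pCons_0_0)
    have "y = poly_op P T ((1 / c) *\<^sub>R y)" for y
      using c by simp
    then have "range (poly_op P T) = UNIV" by blast
    then show ?thesis by simp
  next
    case False
    have "\<not> constant (poly (map_poly of_real P :: complex poly))"
      using False by (simp add: constant_degree degree_map_poly)
    then obtain l :: complex where "poly (map_poly of_real P) l = 0"
      using fundamental_theorem_of_algebra by blast
    then obtain Q where P: "P = real_min_poly l * Q"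
      using real_min_poly_dvd by blast
    have "Q \<noteq> 0" using P less.prems by auto
    moreover have "degree Q < degree P"
      using P less.prems \<open>Q \<noteq> 0\<close> by (auto simp: real_min_poly_def degree_mult_eq)
    ultimately have Q: "closure (range (poly_op Q T)) = UNIV"
      using less.hyps by blast
    let ?m = "poly_op (real_min_poly l) T"
    have "?m ` closure (range (poly_op Q T)) \<subseteq> closure (?m ` range (poly_op Q T))"
      by (rule continuous_image_closure_subset[OF continuous_on_poly_op[OF assms(2)]]) simp
    then have "range ?m \<subseteq> closure (range (poly_op P T))"
      by (simp add: Q P poly_op_mult[OF assms(1)] image_image)
    then have "closure (range ?m) \<subseteq> closure (range (poly_op P T))"
      by (simp add: closure_minimal)
    then show ?thesis
      using dense_range_real_min_poly[OF assms(1-3)] by auto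
  qed
qed

end
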